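(* Let $L$ be a lattice, given by a symmetric bilinear form $\mathfrak{b}$ on a real vector space $V$ and a family of vectors $(\vec{v}_1, \cdots,\vec{v}_k)$, with discreteness parameter $\epsilon_L>0$. Denote by $G_L$ the ($k$-dimensional) Gram matrix of $L$. If $\mathrm{rank}(G_L)=\ell$, there exists a unimodular matrix $U$ of dimension $k$ such that $$ U^{T}\,G_L\,U= \begin{pmatrix} G_\ell & 0 \\ 0 &0 \end{pmatrix}, $$ where $G_\ell$ is a non-degenerate $\ell$-dimensional Gram matrix (i.e. an invertible $\ell\times\ell$ real symmetric matrix).
   Context: $\mathfrak{b}$ is a symmetric bilinear form (not necessarily positive definite, possibly degenerate) on a finite-dimensional real vector space $V$, and $L=\mathbb{Z}\vec{v}_1+\cdots+\mathbb{Z}\vec{v}_k$. The Gram matrix $G_L$ is the $k\times k$ real symmetric matrix with entries $(G_L)_{i,j}=\mathfrak{b}(\vec{v}_i,\vec{v}_j)$. $L$ is called an (indefinite) lattice if it satisfies the discreteness condition: there exists a real $\epsilon_L>0$ such that for every integer coefficient vector $\vec{x}\in\mathbb{Z}^k$, $\Vert G_L\cdot\vec{x}\Vert<\epsilon_L$ implies $\Vert G_L\cdot\vec{x}\Vert=0$ (Euclidean norm); the minimal such $\epsilon_L$ is the discreteness parameter. $U^{T}$ denotes the transpose of $U$; a unimodular matrix is an integer matrix with determinant $\pm1$. *)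

theory Defs
  imports
    "HOL-Analysis.Linear_Algebra"
    "HOL-Analysis.L2_Norm"
    "Jordan_Normal_Form.DL_Rank"
begin

definition gram_mat :: "('v \<Rightarrow> 'v \<Rightarrow> real) \<Rightarrow> nat \<Rightarrow> (nat \<Rightarrow> 'v) \<Rightarrow> real mat" where
  "gram_mat b k v = mat k k (\<lambda>(i, j). b (v i) (v j))"

definition euclid_norm :: "real vec \<Rightarrow> real" where
  "euclid_norm x = L2_set (\<lambda>i. x $ i) {..<dim_vec x}"

text \<open>
  If some \<open>\<epsilon>\<close> satisfies the discreteness condition, so does every smaller positive number.
  The extremal value meant by \<^emph>\<open>the discreteness parameter\<close> is therefore the largest one, the
  minimum of the nonzero norms of the vectors \<open>G x\<close>; it does not exist for \<open>G = 0\<close>.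
  The predicate below holds of every admissible \<open>\<epsilon>\<close>, the extremal one included.
\<close>

definition discreteness_param :: "real mat \<Rightarrow> real \<Rightarrow> bool" where
  "discreteness_param G \<epsilon> \<longleftrightarrow> \<epsilon> > 0 \<and>
     (\<forall>x :: int vec. x \<in> carrier_vec (dim_col G) \<longrightarrow>
        euclid_norm (G *\<^sub>v map_vec real_of_int x) < \<epsilon> \<longrightarrow>
        euclid_norm (G *\<^sub>v map_vec real_of_int x) = 0)"

definition unimodular_mat :: "nat \<Rightarrow> int mat \<Rightarrow> bool" where
  "unimodular_mat k U \<longleftrightarrow> U \<in> carrier_mat k k \<and> (det U = 1 \<or> det U = - 1)"

end

theory Submission
  imports Defs "Jordan_Normal_Form.Column_Operations"
begin

text \<open>
  A real linear relation between the columns of a matrix \<open>A\<close> with the discreteness property can be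
  replaced, by Dirichlet approximation, by an integer one with no larger support; integer column
  operations then produce a zero column. Take a unimodular \<open>U\<close> such that all columns of \<open>G U\<close> from
  index \<open>r\<close> on vanish, with \<open>r\<close> minimal: the first \<open>r\<close> columns are linearly independent, so \<open>r\<close> is
  the rank of \<open>G\<close>. By symmetry \<open>U\<^sup>T G U\<close> is supported on its leading \<open>r \<times> r\<close> block, whose kernel is
  trivial because \<open>U\<^sup>T\<close> is injective.
\<close>

section \<open>Column space of a matrix\<close>

text \<open>\<open>rank\<close> is the dimension of this span, so matrices with the same image have
  the same rank; both rank computations below compare images only.\<close>

lemma (in vec_space) span_cols_eq_range:
  assumes A: "A \<in> carrier_mat n nc"
  shows "span (set (cols A)) = (*\<^sub>v) A ` carrier_vec nc"
proof -
  have carr: "set (cols A) \<subseteq> carrier_vec n"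
    using cols_dim[of A] A by auto
  have comb: "lincomb_list c (cols A) = A *\<^sub>v vec nc c" for c
    using lincomb_list_as_mat_mult[of "cols A" c] carr A mat_of_cols_cols[of A]
    by fastforce
  have "vec nc (($) x) = x" if "x \<in> carrier_vec nc" for x :: "'a vec"
    using that by auto
  then have "range (\<lambda>c. A *\<^sub>v vec nc c) = (*\<^sub>v) A ` carrier_vec nc"
    by (auto simp: image_iff) (metis)
  moreover have "span (set (cols A)) = range (\<lambda>c. A *\<^sub>v vec nc c)"
    using span_list_as_span[OF carr] unfolding span_list_def comb by auto
  ultimately show ?thesis by simp
qed

section \<open>Integer kernel vectors by Dirichlet approximation\<close>

lemma mult_mat_vec_index_sum:
  "A \<in> carrier_mat n k \<Longrightarrow> y \<in> carrier_vec k \<Longrightarrow> i < n \<Longrightarrow>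
    (A *\<^sub>v y) $ i = (\<Sum>j<k. A $$ (i, j) * y $ j)"
  by (auto simp: scalar_prod_def atLeast0LessThan)

lemma mult_mat_vec_eq_0_iff_sum:
  "A \<in> carrier_mat n k \<Longrightarrow> y \<in> carrier_vec k \<Longrightarrow>
    A *\<^sub>v y = 0\<^sub>v n \<longleftrightarrow> (\<forall>i<n. (\<Sum>j<k. A $$ (i, j) * y $ j) = 0)"
  by (auto simp: vec_eq_iff mult_mat_vec_index_sum simp del: index_mult_mat_vec)

lemma euclid_norm_le_sum_abs:
  "y \<in> carrier_vec n \<Longrightarrow> euclid_norm y \<le> (\<Sum>i<n. \<bar>y $ i\<bar>)"
  unfolding euclid_norm_def using L2_set_le_sum_abs[of "\<lambda>i. y $ i"] by auto

lemma euclid_norm_eq_0_iff: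
  "y \<in> carrier_vec n \<Longrightarrow> euclid_norm y = 0 \<longleftrightarrow> y = 0\<^sub>v n"
  unfolding euclid_norm_def by (auto simp: L2_set_eq_0_iff vec_eq_iff)

text \<open>Dirichlet's argument: round the multiples \<open>m \<cdot> d\<close> of a suitably scaled kernel vector \<open>d\<close>; two
  multiples with nearly equal fractional parts differ by an integer vector that \<open>A\<close> maps to
  almost \<open>0\<close>, hence to \<open>0\<close>.\<close>

lemma discrete_imp_int_kernel_vec:
  fixes A :: "real mat"
  assumes A: "A \<in> carrier_mat n k" and disc: "discreteness_param A \<epsilon>"
    and c: "c \<in> carrier_vec k" "c \<noteq> 0\<^sub>v k" "A *\<^sub>v c = 0\<^sub>v n"
  obtains x :: "int vec" where "x \<in> carrier_vec k" "x \<noteq> 0\<^sub>v k"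
    "A *\<^sub>v map_vec real_of_int x = 0\<^sub>v n" "\<And>j. j < k \<Longrightarrow> c $ j = 0 \<Longrightarrow> x $ j = 0"
proof -
  obtain p where p: "p < k" "c $ p \<noteq> 0"
    using c by (auto simp: vec_eq_iff)
  \<comment> \<open>Scaling gives \<open>d p = 1\<close>, so entry \<open>p\<close> of the integer
    vector \<open>x\<close> below is exactly \<open>m - m'\<close>, hence nonzero.\<close>
  define d where "d j = c $ j / c $ p" for j
  \<comment> \<open>If every entry of the error is at most \<open>1 / N\<close> in absolute value,
    its image under \<open>A\<close> has norm at most \<open>S / N\<close>; \<open>N\<close> is
    chosen to push this below the discreteness bound.\<close>
  define S where "S = (\<Sum>i<n. \<Sum>j<k. \<bar>A $$ (i, j)\<bar>)"
  have \<epsilon>: "\<epsilon> > 0" using disc unfolding discreteness_param_def by simp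
  obtain N :: nat where N: "N > 0" "S / N < \<epsilon>"
  proof -
    obtain N :: nat where "real N > S / \<epsilon>" using reals_Archimedean2 by blast
    then have "S < \<epsilon> * (real N + 1)" using \<epsilon> by (simp add: field_simps)
    then have "S / real (Suc N) < \<epsilon>" by (simp add: field_simps)
    then show ?thesis using that[of "Suc N"] by blast
  qed
  \<comment> \<open>The cell containing the fractional parts in a grid of mesh \<open>1 / N\<close>.
    Restriction to \<open>{..<k}\<close> makes \<open>f m\<close> extensional, so only finitely many
    values occur while \<open>m\<close> runs over all naturals.\<close>
  define f where "f m = (\<lambda>j\<in>{..<k}. \<lfloor>real N * frac (real m * d j)\<rfloor>)" for m :: nat
  have "range f \<subseteq> {..<k} \<rightarrow>\<^sub>E {0..<int N}"
    using N by (auto simp: f_def floor_less_iff frac_lt_1 split: if_splits)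
  then have "finite (range f)"
    by (rule finite_subset) (intro finite_PiE, auto)
  then have "\<not> inj f" using finite_imageD[of f UNIV] by auto
  then obtain m m' where mm: "m \<noteq> m'" "f m = f m'" by (auto simp: inj_def)
  define x where "x = vec k (\<lambda>j. \<lfloor>real m * d j\<rfloor> - \<lfloor>real m' * d j\<rfloor>)"
  define e where "e j = frac (real m' * d j) - frac (real m * d j)" for j
  have e: "\<bar>e j\<bar> \<le> 1 / N" if "j < k" for j
  proof -
    have "\<lfloor>real N * frac (real m * d j)\<rfloor> = \<lfloor>real N * frac (real m' * d j)\<rfloor>"
      using fun_cong[OF mm(2), of j] that by (simp add: f_def)
    then have "\<bar>real N * frac (real m' * d j) - real N * frac (real m * d j)\<bar> \<le> 1"
      by linarith
    then have "real N * \<bar>e j\<bar> \<le> 1"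
      using N(1) by (simp add: e_def abs_mult flip: right_diff_distrib)
    then show ?thesis using N(1) by (simp add: field_simps)
  qed
  have x: "x \<in> carrier_vec k" by (simp add: x_def)
  \<comment> \<open>A multiple of the kernel vector \<open>c\<close> plus the small error
    \<open>e\<close>: only the error survives multiplication by \<open>A\<close>.\<close>
  have xj: "real_of_int (x $ j) = (real m - real m') / c $ p * c $ j + e j" if "j < k" for j
    using that p by (simp add: x_def e_def frac_def d_def field_simps)
  have Ax: "(A *\<^sub>v map_vec real_of_int x) $ i = (\<Sum>j<k. A $$ (i, j) * e j)" if "i < n" for i
  proof -
    have "(A *\<^sub>v map_vec real_of_int x) $ i = (\<Sum>j<k. A $$ (i, j) * real_of_int (x $ j))"
      using x that mult_mat_vec_index_sum[OF A, of "map_vec real_of_int x" i] by simp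
    also have "\<dots> = (\<Sum>j<k. (real m - real m') / c $ p * (A $$ (i, j) * c $ j) + A $$ (i, j) * e j)"
      by (intro sum.cong refl) (simp add: xj, simp add: algebra_simps)
    also have "\<dots> = (real m - real m') / c $ p * (\<Sum>j<k. A $$ (i, j) * c $ j)
        + (\<Sum>j<k. A $$ (i, j) * e j)"
      by (simp add: sum.distrib sum_distrib_left)
    also have "(\<Sum>j<k. A $$ (i, j) * c $ j) = 0"
      using mult_mat_vec_eq_0_iff_sum[OF A c(1)] c(3) that by simp
    finally show ?thesis by simp
  qed
  have carr: "A *\<^sub>v map_vec real_of_int x \<in> carrier_vec n" using A x by auto
  have "euclid_norm (A *\<^sub>v map_vec real_of_int x) \<le> (\<Sum>i<n. \<Sum>j<k. \<bar>A $$ (i, j)\<bar> * (1 / N))"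
  proof (rule order_trans[OF euclid_norm_le_sum_abs[OF carr]], rule sum_mono)
    fix i assume "i \<in> {..<n}"
    then have "\<bar>(A *\<^sub>v map_vec real_of_int x) $ i\<bar> \<le> (\<Sum>j<k. \<bar>A $$ (i, j) * e j\<bar>)"
      by (simp only: Ax lessThan_iff sum_abs)
    also have "\<dots> \<le> (\<Sum>j<k. \<bar>A $$ (i, j)\<bar> * (1 / N))"
      by (intro sum_mono) (use e in \<open>auto simp only: abs_mult lessThan_iff intro!: mult_left_mono\<close>)
    finally show "\<bar>(A *\<^sub>v map_vec real_of_int x) $ i\<bar> \<le> (\<Sum>j<k. \<bar>A $$ (i, j)\<bar> * (1 / N))" .
  qed
  also have "\<dots> = S / N" by (simp add: S_def sum_divide_distrib)
  also note N(2)
  finally have "A *\<^sub>v map_vec real_of_int x = 0\<^sub>v n"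
    using disc x A carr euclid_norm_eq_0_iff[OF carr] unfolding discreteness_param_def by auto
  moreover have "x $ p \<noteq> 0" using p mm by (simp add: x_def d_def)
  then have "x \<noteq> 0\<^sub>v k" using p by auto
  \<comment> \<open>Zeros of \<open>c\<close> are zeros of \<open>d\<close>, and rounding keeps
    them. This lets the column reduction work inside the leading columns.\<close>
  moreover have "x $ j = 0" if "j < k" "c $ j = 0" for j using that by (simp add: x_def d_def)
  ultimately show ?thesis using that x by blast
qed

section \<open>Unimodular matrices and integer column operations\<close>

lemma unimodular_mat_mult:
  "unimodular_mat k U \<Longrightarrow> unimodular_mat k V \<Longrightarrow> unimodular_mat k (U * V)"
  unfolding unimodular_mat_def by (auto simp: det_mult)

lemma unimodular_mat_addrow_mat: "i \<noteq> j \<Longrightarrow> unimodular_mat k (addrow_mat k a i j)"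
  unfolding unimodular_mat_def by (simp add: det_addrow_mat)

lemma unimodular_mat_swaprows_mat:
  "i < k \<Longrightarrow> j < k \<Longrightarrow> unimodular_mat k (swaprows_mat k i j)"
\<comment> \<open>Equal indices do occur: the single entry left by the Euclidean algorithm may
  already be in its target position.\<close>
proof (cases "i = j")
  case True
  assume "i < k"
  then have "swaprows_mat k i j = (1\<^sub>m k :: int mat)" unfolding True by (intro eq_matI) auto
  then show ?thesis by (simp add: unimodular_mat_def)
qed (simp add: unimodular_mat_def det_swaprows_mat)

lemma map_mat_addrow_mat:
  "map_mat real_of_int (addrow_mat k a i j) = addrow_mat k (real_of_int a) i j"
  by (intro eq_matI) auto

lemma map_mat_swaprows_mat:
  "map_mat real_of_int (swaprows_mat k i j) = swaprows_mat k i j"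
  by (intro eq_matI) auto

lemma map_mat_of_int_mult:
  assumes "U \<in> carrier_mat k k" "V \<in> carrier_mat k k"
  shows "map_mat real_of_int (U * V) = map_mat real_of_int U * map_mat real_of_int V"
  using of_int_hom.mat_hom_mult[OF assms] .

lemma addrow_mat_mult_vec:
  assumes "x \<in> carrier_vec k" "i < k" "j < k" "i \<noteq> j"
  shows "addrow_mat k a i j *\<^sub>v x = vec k (\<lambda>m. if m = i then a * x $ j + x $ i else x $ m)"
    (is "?l = ?r")
proof (rule eq_vecI)
  fix m assume "m < dim_vec ?r"
  then show "?l $ m = ?r $ m"
    using assms by (cases "m = i")
      (auto simp: row_addrow add_scalar_prod_distrib[of _ k] smult_scalar_prod_distrib[of _ k])
qed auto

text \<open>The Euclidean algorithm on the entries of \<open>x\<close>, performed by column operations on \<open>B\<close>: each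
  step subtracts from a nonzero entry another one of at most the same absolute value, until a
  single nonzero entry is left; the column of \<open>B\<close> it belongs to is then \<open>0\<close>.\<close>

lemma int_kernel_vec_imp_zero_col:
  fixes B :: "real mat" and x :: "int vec"
  assumes "B \<in> carrier_mat n k" "x \<in> carrier_vec k" "x \<noteq> 0\<^sub>v k"
    and "B *\<^sub>v map_vec real_of_int x = 0\<^sub>v n"
    and "r < k" "\<And>j. r < j \<Longrightarrow> j < k \<Longrightarrow> x $ j = 0"
    and "\<And>i j. i < n \<Longrightarrow> r < j \<Longrightarrow> j < k \<Longrightarrow> B $$ (i, j) = 0"
  shows "\<exists>V. unimodular_mat k V \<and>
    (\<forall>i<n. \<forall>j. r \<le> j \<longrightarrow> j < k \<longrightarrow> (B * map_mat real_of_int V) $$ (i, j) = 0)"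
  using assms
proof (induction "\<Sum>j<k. nat \<bar>x $ j\<bar>" arbitrary: x B rule: less_induct)
  case less
  note B = less.prems(1) and x = less.prems(2)
  show ?case
  proof (cases "\<exists>i j. i < k \<and> j < k \<and> i \<noteq> j \<and> x $ i \<noteq> 0 \<and> x $ j \<noteq> 0")
    case True
    then obtain i j where ij: "i < k" "j < k" "i \<noteq> j" "x $ i \<noteq> 0" "x $ j \<noteq> 0"
      and le: "\<bar>x $ j\<bar> \<le> \<bar>x $ i\<bar>" by (metis linear)
    \<comment> \<open>The product of the two signs, so that the new entry has absolute value \<bar>x
      $ i\<bar> - \<bar>x $ j\<bar>.\<close>
    define s :: int where "s = (if (x $ i > 0) = (x $ j > 0) then 1 else - 1)"
    have s: "\<bar>x $ i - s * x $ j\<bar> < \<bar>x $ i\<bar>" using le ij by (auto simp: s_def)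
    define y where "y = vec k (\<lambda>m. if m = i then x $ i - s * x $ j else x $ m)"
    let ?E = "addrow_mat k s i j" and ?R = "addrow_mat k (real_of_int s) i j"
    have y: "y \<in> carrier_vec k" by (simp add: y_def)
    \<comment> \<open>The column operation on \<open>B\<close> undoes the change of the vector, so
      \<open>y\<close> lies in the kernel of \<open>B * ?R\<close>.\<close>
    have Ey: "?R *\<^sub>v map_vec real_of_int y = map_vec real_of_int x"
      using ij x y by (subst addrow_mat_mult_vec) (auto simp: y_def)
    have "(\<Sum>m<k. nat \<bar>y $ m\<bar>) < (\<Sum>m<k. nat \<bar>x $ m\<bar>)"
      by (rule sum_strict_mono_ex1) (use s ij in \<open>auto simp: y_def intro!: bexI[of _ i]\<close>)
    moreover have BE: "B * ?R \<in> carrier_mat n k" using B by simp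
    moreover note y
    moreover have "y $ j \<noteq> 0" using ij by (simp add: y_def)
    then have "y \<noteq> 0\<^sub>v k" using ij by auto
    moreover have "(B * ?R) *\<^sub>v map_vec real_of_int y = 0\<^sub>v n"
      using less.prems(4) y by (subst assoc_mult_mat_vec[OF B, of _ k]) (auto simp: Ey)
    moreover note \<open>r < k\<close>
    \<comment> \<open>Both indices lie in the support of \<open>x\<close>, so the zero columns
      beyond \<open>r\<close> are left alone.\<close>
    moreover have r: "i \<le> r" "j \<le> r" using less.prems(6) ij by (meson not_le)+
    then have "y $ m = 0" if "r < m" "m < k" for m
      using that less.prems(6) by (auto simp: y_def)
    moreover have "(B * ?R) $$ (p, q) = 0" if "p < n" "r < q" "q < k" for p q
      using that B less.prems(7) r ij by (subst addcol_mat[symmetric, OF B]) auto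
    ultimately obtain V where V: "unimodular_mat k V"
      "\<forall>p<n. \<forall>q. r \<le> q \<longrightarrow> q < k \<longrightarrow> (B * ?R * map_mat real_of_int V) $$ (p, q) = 0"
      using less.hyps[of y "B * ?R"] by blast
    have Vc: "V \<in> carrier_mat k k" using V by (simp add: unimodular_mat_def)
    have "B * map_mat real_of_int (?E * V) = B * ?R * map_mat real_of_int V"
      unfolding map_mat_of_int_mult[OF addrow_mat_carrier Vc] map_mat_addrow_mat
      by (rule assoc_mult_mat[OF B addrow_mat_carrier, symmetric]) (use Vc in auto)
    then show ?thesis
      using V unimodular_mat_mult[OF unimodular_mat_addrow_mat[OF ij(3)] V(1)] by metis
  next
    case False
    obtain m where m: "m < k" "x $ m \<noteq> 0" using less.prems(2,3) by (auto simp: vec_eq_iff)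
    have mr: "m \<le> r" using m less.prems(6) by (meson not_le)
    have Bm: "B $$ (i, m) = 0" if "i < n" for i
    proof -
      have "0 = (\<Sum>j<k. B $$ (i, j) * real_of_int (x $ j))"
        using less.prems(4) x that mult_mat_vec_eq_0_iff_sum[OF B, of "map_vec real_of_int x"] by simp
      also have "\<dots> = (\<Sum>j<k. if j = m then B $$ (i, m) * real_of_int (x $ m) else 0)"
        by (intro sum.cong refl) (use False m in auto)
      finally show ?thesis using m by simp
    qed
    \<comment> \<open>The zero column \<open>m\<close> moves to position \<open>r\<close>; since
      \<open>m \<le> r\<close>, the zero columns beyond \<open>r\<close> stay in place.\<close>
    have "(B * swaprows_mat k m r) $$ (i, j) = 0" if "i < n" "r \<le> j" "j < k" for i j
      using that B less.prems(7) mr m Bm \<open>r < k\<close> by (subst swapcols_mat[symmetric, OF B]) auto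
    then show ?thesis
      using unimodular_mat_swaprows_mat[OF m(1) \<open>r < k\<close>] map_mat_swaprows_mat by metis
  qed
qed

section \<open>Column reduction by minimality\<close>

text \<open>An integer \<open>U\<close> sends integer vectors to integer vectors, so the new matrix
  takes on them only values that \<open>A\<close> already takes.\<close>

lemma discreteness_param_mult_int:
  assumes A: "A \<in> carrier_mat n k" and U: "U \<in> carrier_mat k k"
    and disc: "discreteness_param A \<epsilon>"
  shows "discreteness_param (A * map_mat real_of_int U) \<epsilon>"
proof -
  have "(A * map_mat real_of_int U) *\<^sub>v map_vec real_of_int x = A *\<^sub>v map_vec real_of_int (U *\<^sub>v x)"
    if x: "x \<in> carrier_vec k" for x
    using x U by (subst assoc_mult_mat_vec[OF A, of _ k])
      (auto simp: of_int_hom.mult_mat_vec_hom[OF U x])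
  then show ?thesis
    using disc A U unfolding discreteness_param_def by auto
qed

text \<open>Minimality of \<open>r\<close> replaces an iteration: a real relation among the first
  \<open>r\<close> columns would become an integer one, and the Euclidean step would clear one more
  column.\<close>

lemma discrete_column_reduction:
  assumes A: "A \<in> carrier_mat n k" and disc: "discreteness_param A \<epsilon>"
  obtains U r where "unimodular_mat k U" "r \<le> k"
    "\<And>i j. i < n \<Longrightarrow> r \<le> j \<Longrightarrow> j < k \<Longrightarrow> (A * map_mat real_of_int U) $$ (i, j) = 0"
    "\<And>c. c \<in> carrier_vec k \<Longrightarrow> (\<And>j. r \<le> j \<Longrightarrow> j < k \<Longrightarrow> c $ j = 0) \<Longrightarrow>
      (A * map_mat real_of_int U) *\<^sub>v c = 0\<^sub>v n \<Longrightarrow> c = 0\<^sub>v k"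
proof -
  define P where "P r \<longleftrightarrow> (\<exists>U. unimodular_mat k U \<and>
    (\<forall>i<n. \<forall>j. r \<le> j \<longrightarrow> j < k \<longrightarrow> (A * map_mat real_of_int U) $$ (i, j) = 0))" for r
  define r where "r = (LEAST r. P r)"
  have Pk: "P k" unfolding P_def by (intro exI[of _ "1\<^sub>m k"]) (auto simp: unimodular_mat_def)
  have "P r" "r \<le> k" unfolding r_def using Pk by (auto intro: LeastI Least_le)
  then obtain U where U: "unimodular_mat k U"
    "\<forall>i<n. \<forall>j. r \<le> j \<longrightarrow> j < k \<longrightarrow> (A * map_mat real_of_int U) $$ (i, j) = 0"
    unfolding P_def by blast
  define B where "B = A * map_mat real_of_int U"
  have Uc: "U \<in> carrier_mat k k" using U by (simp add: unimodular_mat_def)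
  have B: "B \<in> carrier_mat n k" using A Uc by (simp add: B_def)
  have "c = 0\<^sub>v k" if c: "c \<in> carrier_vec k" "\<And>j. r \<le> j \<Longrightarrow> j < k \<Longrightarrow> c $ j = 0"
    "B *\<^sub>v c = 0\<^sub>v n" for c
  proof (rule ccontr)
    assume c0: "c \<noteq> 0\<^sub>v k"
    then obtain p where "p < k" "c $ p \<noteq> 0" using c by (auto simp: vec_eq_iff)
    \<comment> \<open>A nonzero \<open>c\<close> supported below \<open>r\<close> forces
      \<open>r > 0\<close>. The index \<open>q\<close> is that of the last column not yet known to
      vanish, and the support of \<open>c\<close> ends at \<open>q\<close> at the latest.\<close>
    then obtain q where q: "r = Suc q" using c(2) by (cases r) auto
    have "discreteness_param B \<epsilon>"
      unfolding B_def by (rule discreteness_param_mult_int[OF A Uc disc])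
    then obtain x :: "int vec" where x: "x \<in> carrier_vec k" "x \<noteq> 0\<^sub>v k"
      "B *\<^sub>v map_vec real_of_int x = 0\<^sub>v n" "\<And>j. j < k \<Longrightarrow> c $ j = 0 \<Longrightarrow> x $ j = 0"
      using discrete_imp_int_kernel_vec[OF B _ c(1) c0 c(3)] by blast
    have "q < k" using q \<open>r \<le> k\<close> by simp
    moreover have "x $ j = 0" if "q < j" "j < k" for j
      using that x(4) c(2) q by simp
    moreover have "B $$ (i, j) = 0" if "i < n" "q < j" "j < k" for i j
      using that U(2) q unfolding B_def by simp
    ultimately obtain V where V: "unimodular_mat k V"
      "\<forall>i<n. \<forall>j. q \<le> j \<longrightarrow> j < k \<longrightarrow> (B * map_mat real_of_int V) $$ (i, j) = 0"
      using int_kernel_vec_imp_zero_col[OF B x(1-3), of q] by blast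
    have Vc: "V \<in> carrier_mat k k" using V by (simp add: unimodular_mat_def)
    have "B * map_mat real_of_int V = A * map_mat real_of_int (U * V)"
      unfolding B_def map_mat_of_int_mult[OF Uc Vc] by (rule assoc_mult_mat[OF A]) (use Uc Vc in auto)
    then have "P q" unfolding P_def using V unimodular_mat_mult[OF U(1) V(1)] by metis
    then have "r \<le> q" unfolding r_def by (rule Least_le)
    then show False using q by simp
  qed
  then show ?thesis using that[of U r] U \<open>r \<le> k\<close> unfolding B_def by blast
qed

section \<open>Rank of the reduced matrix\<close>

text \<open>\<open>W\<close> maps the coordinate space onto itself, so the image of \<open>A\<close>
  is unchanged.\<close>

lemma (in vec_space) rank_mult_invertible:
  assumes A: "A \<in> carrier_mat n k" and W: "W \<in> carrier_mat k k" "invertible_mat W"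
  shows "rank (A * W) = rank A"
proof -
  obtain W' where W': "W * W' = 1\<^sub>m k" "W' * W = 1\<^sub>m (dim_row W')"
    using W unfolding invertible_mat_def inverts_mat_def by auto
  \<comment> \<open>\<open>invertible_mat\<close> does not state the format of the inverse; it is
    read off from the two products.\<close>
  have W'c: "W' \<in> carrier_mat k k"
    using W' W by (metis carrier_mat_triv carrier_matD(2) index_mult_mat(3) index_one_mat(3))
  have "(*\<^sub>v) W ` carrier_vec k = carrier_vec k"
  proof
    show "carrier_vec k \<subseteq> (*\<^sub>v) W ` carrier_vec k"
    proof
      fix x :: "'a vec" assume x: "x \<in> carrier_vec k"
      then have "x = W *\<^sub>v (W' *\<^sub>v x)"
        using W'(1) by (subst assoc_mult_mat_vec[OF W(1) W'c x, symmetric]) auto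
      then show "x \<in> (*\<^sub>v) W ` carrier_vec k" using W'c x by (metis imageI mult_mat_vec_carrier)
    qed
  qed (use W in auto)
  moreover have "(*\<^sub>v) (A * W) ` carrier_vec k = (*\<^sub>v) A ` (*\<^sub>v) W ` carrier_vec k"
    unfolding image_image by (intro image_cong refl assoc_mult_mat_vec[OF A W(1)])
  ultimately have "span (set (cols (A * W))) = span (set (cols A))"
    using span_cols_eq_range[OF A] span_cols_eq_range[of "A * W" k] A W by simp
  then show ?thesis unfolding rank_def by simp
qed

text \<open>The matrix \<open>D\<close> of the first \<open>r\<close> columns has the same image as
  \<open>B\<close> and, by \<open>indep\<close>, trivial kernel, hence full column rank.\<close>

lemma (in vec_space) rank_eq_if_zero_cols:
  assumes B: "B \<in> carrier_mat n k" and r: "r \<le> k"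
    and zero: "\<And>i j. i < n \<Longrightarrow> r \<le> j \<Longrightarrow> j < k \<Longrightarrow> B $$ (i, j) = 0"
    and indep: "\<And>c. c \<in> carrier_vec k \<Longrightarrow> (\<And>j. r \<le> j \<Longrightarrow> j < k \<Longrightarrow> c $ j = 0) \<Longrightarrow>
      B *\<^sub>v c = 0\<^sub>v n \<Longrightarrow> c = 0\<^sub>v k"
  shows "rank B = r"
proof -
  define D where "D = mat n r (\<lambda>ij. B $$ ij)"
  define pad where "pad y = vec k (\<lambda>j. if j < r then y $ j else 0)" for y :: "'a vec"
  have D: "D \<in> carrier_mat n r" by (simp add: D_def)
  have pad: "pad y \<in> carrier_vec k" for y by (simp add: pad_def)
  have BD: "B *\<^sub>v c = D *\<^sub>v vec r (($) c)" if c: "c \<in> carrier_vec k" for c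
  proof (rule eq_vecI)
    fix i assume "i < dim_vec (D *\<^sub>v vec r (($) c))"
    then have i: "i < n" by (simp add: D_def)
    have "(B *\<^sub>v c) $ i = (\<Sum>j<k. B $$ (i, j) * c $ j)"
      by (rule mult_mat_vec_index_sum[OF B c i])
    also have "\<dots> = (\<Sum>j<r. B $$ (i, j) * c $ j)"
      by (rule sum.mono_neutral_right) (use r zero i in auto)
    also have "\<dots> = (\<Sum>j<r. D $$ (i, j) * vec r (($) c) $ j)"
      using i by (simp add: D_def)
    also have "\<dots> = (D *\<^sub>v vec r (($) c)) $ i"
      using mult_mat_vec_index_sum[OF D _ i, of "vec r (($) c)"] by simp
    finally show "(B *\<^sub>v c) $ i = (D *\<^sub>v vec r (($) c)) $ i" .
  qed (use B D in auto)
  have DB: "D *\<^sub>v y = B *\<^sub>v pad y" if "y \<in> carrier_vec r" for y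
  proof -
    have "vec r (($) (pad y)) = y" using that r by (auto simp: pad_def)
    then show ?thesis using BD[OF pad] by simp
  qed
  have inj: "y = 0\<^sub>v r" if y: "y \<in> carrier_vec r" "D *\<^sub>v y = 0\<^sub>v n" for y
  proof -
    have "pad y = 0\<^sub>v k" using y(2) by (intro indep[OF pad]) (auto simp: pad_def DB[OF y(1)])
    then have "pad y $ j = 0" if "j < r" for j using that r by simp
    then show ?thesis using y(1) r by (auto simp: pad_def)
  qed
  \<comment> \<open>Independence is stated for the set of columns, where repetitions would be lost.
    Equal columns would put a difference of two unit vectors into the kernel.\<close>
  have "distinct (cols D)"
  proof (rule ccontr)
    assume "\<not> distinct (cols D)"
    then obtain p q where pq: "p < r" "q < r" "p \<noteq> q" "col D p = col D q"
      using D by (auto simp: distinct_conv_nth)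
    have "D *\<^sub>v unit_vec r j = col D j" if "j < r" for j
      using D that by (intro eq_vecI) auto
    then have "D *\<^sub>v (unit_vec r p - unit_vec r q) = col D p - col D q"
      using pq by (simp add: mult_minus_distrib_mat_vec[OF D])
    then have "unit_vec r p - unit_vec r q = (0\<^sub>v r :: 'a vec)"
      using D pq by (intro inj) auto
    then have "(unit_vec r p - unit_vec r q :: 'a vec) $ p = 0" using pq by simp
    then show False using pq by simp
  qed
  moreover have "lin_indpt (set (cols D))"
    using lin_depE[OF D _ \<open>distinct (cols D)\<close>] inj by blast
  ultimately have "rank D = r" using lin_indpt_full_rank[OF D] by blast
  moreover have "(*\<^sub>v) B ` carrier_vec k = (*\<^sub>v) D ` carrier_vec r"
  proof (intro equalityI image_subsetI)
    show "B *\<^sub>v c \<in> (*\<^sub>v) D ` carrier_vec r" if "c \<in> carrier_vec k" for c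
      unfolding BD[OF that] by (intro imageI) simp
    show "D *\<^sub>v y \<in> (*\<^sub>v) B ` carrier_vec k" if "y \<in> carrier_vec r" for y
      unfolding DB[OF that] by (intro imageI pad)
  qed
  then have "rank B = rank D"
    unfolding rank_def span_cols_eq_range[OF B] span_cols_eq_range[OF D] by simp
  ultimately show ?thesis by simp
qed

lemma invertible_mat_if_det_nonzero:
  fixes A :: "'a :: field mat"
  assumes A: "A \<in> carrier_mat n n" and "det A \<noteq> 0"
  shows "invertible_mat A"
proof -
  obtain B where "B \<in> carrier_mat n n" "B * A = 1\<^sub>m n" "A * B = 1\<^sub>m n"
    using det_non_zero_imp_unit[OF assms, of undefined]
    by (auto simp: Units_def ring_mat_def)
  then show ?thesis
    using A unfolding invertible_mat_def inverts_mat_def by (auto intro!: exI[of _ B])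
qed

section \<open>Block form of the Gram matrix\<close>

theorem theorem3p1:
  fixes b :: "'v::real_vector \<Rightarrow> 'v \<Rightarrow> real"
    and v :: "nat \<Rightarrow> 'v" and k l :: nat and \<epsilon> :: real
  assumes "\<exists>B :: 'v set. finite B \<and> real_vector.span B = UNIV"
    and "bilinear b" and "\<And>x y. b x y = b y x"
    and "discreteness_param (gram_mat b k v) \<epsilon>"
    and "vec_space.rank k (gram_mat b k v) = l"
  shows "\<exists>U G\<^sub>l. unimodular_mat k U \<and>
    transpose_mat (map_mat real_of_int U) * gram_mat b k v * map_mat real_of_int U
      = four_block_mat G\<^sub>l (0\<^sub>m l (k - l)) (0\<^sub>m (k - l) l) (0\<^sub>m (k - l) (k - l)) \<and>
    G\<^sub>l \<in> carrier_mat l l \<and> transpose_mat G\<^sub>l = G\<^sub>l \<and> invertible_mat G\<^sub>l"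
proof -
  define G where "G = gram_mat b k v"
  have G: "G \<in> carrier_mat k k" by (simp add: G_def gram_mat_def)
  have Gsym: "transpose_mat G = G"
    using assms(3) by (auto simp: G_def gram_mat_def)
  obtain U r where U: "unimodular_mat k U" and r: "r \<le> k"
    and zero: "\<And>i j. i < k \<Longrightarrow> r \<le> j \<Longrightarrow> j < k \<Longrightarrow> (G * map_mat real_of_int U) $$ (i, j) = 0"
    and indep: "\<And>c. c \<in> carrier_vec k \<Longrightarrow> (\<And>j. r \<le> j \<Longrightarrow> j < k \<Longrightarrow> c $ j = 0) \<Longrightarrow>
      (G * map_mat real_of_int U) *\<^sub>v c = 0\<^sub>v k \<Longrightarrow> c = 0\<^sub>v k"
    using discrete_column_reduction[OF G] assms(4) unfolding G_def by blast
  define W where "W = map_mat real_of_int U"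
  have W: "W \<in> carrier_mat k k" and detW: "det W \<noteq> 0"
    using U by (auto simp: W_def unimodular_mat_def)
  note zero = zero[folded W_def] and indep = indep[folded W_def]
  interpret vec_space "TYPE(real)" k .
  have GW: "G * W \<in> carrier_mat k k" using G W by simp
  have "rank (G * W) = rank G"
    by (rule rank_mult_invertible[OF G W invertible_mat_if_det_nonzero[OF W detW]])
  moreover have "rank (G * W) = r"
    by (rule rank_eq_if_zero_cols[OF GW r zero indep])
  ultimately have rl: "r = l"
    using assms(5) unfolding G_def by simp
  define M where "M = transpose_mat W * G * W"
  have M: "M \<in> carrier_mat k k" using G W by (simp add: M_def)
  have M_eq: "M = transpose_mat W * (G * W)"
    unfolding M_def by (rule assoc_mult_mat) (use G W in auto)
  have "transpose_mat M = transpose_mat (G * W) * W"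
    unfolding M_eq using G W by (subst transpose_mult[of _ k k]) auto
  also have "\<dots> = M"
    unfolding M_def using G W Gsym by (subst transpose_mult[OF G W]) auto
  finally have Msym: "transpose_mat M = M" .
  have M_swap: "M $$ (i, j) = M $$ (j, i)" if "i < k" "j < k" for i j
    using that M Msym by (metis carrier_matD index_transpose_mat(1))
  \<comment> \<open>Multiplying by \<open>W\<close> transposed on the left preserves the zero
    columns of \<open>G * W\<close>; \<open>M_swap\<close> then gives the zero rows.\<close>
  have M_col: "M $$ (i, j) = 0" if "i < k" "r \<le> j" "j < k" for i j
    unfolding M_eq using that G W zero by (auto simp: scalar_prod_def)
  define H where "H = mat r r (\<lambda>ij. M $$ ij)"
  have H: "H \<in> carrier_mat r r" by (simp add: H_def)
  have "M = four_block_mat H (0\<^sub>m r (k - r)) (0\<^sub>m (k - r) r) (0\<^sub>m (k - r) (k - r))" (is "_ = ?F")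
  proof (rule eq_matI)
    fix i j assume "i < dim_row ?F" "j < dim_col ?F"
    then have "i < k" "j < k" using H r by auto
    then show "M $$ (i, j) = ?F $$ (i, j)"
      using H M_col M_swap[of i j] r by (auto simp: H_def not_less)
  qed (use M H r in auto)
  moreover have "transpose_mat H = H"
    using M_swap r by (auto simp: H_def)
  moreover have "invertible_mat H"
  proof (rule invertible_mat_if_det_nonzero[OF H], rule notI)
    assume "det H = 0"
    then obtain y where y: "y \<in> carrier_vec r" "y \<noteq> 0\<^sub>v r" "H *\<^sub>v y = 0\<^sub>v r"
      using det_0_iff_vec_prod_zero_field[OF H] by blast
    \<comment> \<open>Padding with zeros turns a kernel vector of \<open>H\<close> into one of
      \<open>M\<close>, because \<open>M\<close> vanishes outside its leading block.\<close>
    define c where "c = vec k (\<lambda>j. if j < r then y $ j else 0)"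
    have c: "c \<in> carrier_vec k" by (simp add: c_def)
    have "M *\<^sub>v c = 0\<^sub>v k"
    proof (subst mult_mat_vec_eq_0_iff_sum[OF M c], intro allI impI)
      fix i assume i: "i < k"
      have "(\<Sum>j<k. M $$ (i, j) * c $ j) = (\<Sum>j<r. M $$ (i, j) * c $ j)"
        by (rule sum.mono_neutral_right) (use r i M_col in auto)
      also have "\<dots> = 0"
      proof (cases "i < r")
        case True
        have "(\<Sum>j<r. M $$ (i, j) * c $ j) = (\<Sum>j<r. H $$ (i, j) * y $ j)"
          using True r by (intro sum.cong) (auto simp: H_def c_def)
        then show ?thesis using mult_mat_vec_eq_0_iff_sum[OF H y(1)] y(3) True by simp
      next
        case False
        then show ?thesis using i r M_swap[of i] M_col by (intro sum.neutral) auto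
      qed
      finally show "(\<Sum>j<k. M $$ (i, j) * c $ j) = 0" .
    qed
    \<comment> \<open>The transpose of \<open>W\<close> has nonzero determinant and can be
      cancelled; \<open>c\<close> is supported below \<open>r\<close>, so \<open>indep\<close>
      forces it to be zero.\<close>
    then have "transpose_mat W *\<^sub>v ((G * W) *\<^sub>v c) = 0\<^sub>v k"
      unfolding M_eq using W GW c by (subst (asm) assoc_mult_mat_vec) auto
    moreover have "det (transpose_mat W) \<noteq> 0" using detW det_transpose[OF W] by simp
    ultimately have "(G * W) *\<^sub>v c = 0\<^sub>v k"
      using det_0_iff_vec_prod_zero_field[of "transpose_mat W" k] W GW c
      by (metis mult_mat_vec_carrier transpose_carrier_mat)
    then have "c = 0\<^sub>v k" by (rule indep[OF c, rotated]) (simp add: c_def)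
    then have "c $ j = 0" if "j < r" for j using that r by simp
    then have "y = 0\<^sub>v r" using y(1) r by (auto simp: c_def)
    then show False using y(2) by simp
  qed
  ultimately show ?thesis
    using U H unfolding M_def W_def G_def rl by blast
qed

end
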